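(* Let $n_1,n_2,n_3\ge 1$, $N=n_1+n_2+n_3$, and let $\{x_{ji}: i=1,\ldots,n_j\}\subset\mathbb{R}^p$, $j=1,2,3$, be three samples. For $\rho\in(0,1)$, $\beta=(\beta_0,\beta_1^{T})^{T}\in\mathbb{R}^{1+p}$ and $\alpha\in(0,1)$ let $$\kappa(\rho,\beta,\alpha)=\frac1N\sum_{j=1}^3\sum_{i=1}^{n_j}\log\left\{\frac{1-\rho_j+\rho_j\exp(\beta_0+\beta_1^{T}x_{ji})}{1-\alpha+\alpha\exp(\beta_0+\beta_1^{T}x_{ji})}\right\}-\log N,\qquad \rho_1=0,\ \rho_2=1,\ \rho_3=\rho.$$ Let $\tilde\alpha(\rho)=(n_2+n_3\rho)/N$, and let $\hat\alpha(\beta)$ be a minimizer of $\kappa(\rho,\beta,\alpha)$ over $\alpha\in(0,1)$. Then $(\hat\rho,\hat\beta)$ is a local (respectively global) maximizer of the function $(\rho,\beta)\mapsto\kappa\{\rho,\beta,\tilde\alpha(\rho)\}$ (the average log-likelihood in the semi-supervised logistic regression model) if and only if it is a local (respectively global) maximizer of the function $(\rho,\beta)\mapsto\kappa\{\rho,\beta,\hat\alpha(\beta)\}$ (the average profile log-likelihood in the exponential tilt mixture model).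
   Context: The function $\kappa(\rho,\beta,\alpha)$ is convex in $\alpha\in(0,1)$, and its dependence on $\alpha$ does not involve $\rho$; the minimizer $\hat\alpha(\beta)$ is thus free of $\rho$ and satisfies the stationarity condition $1=\frac1N\sum_{j=1}^3\sum_{i=1}^{n_j}\{1-\hat\alpha(\beta)+\hat\alpha(\beta)\exp(\beta_0+\beta_1^{T}x_{ji})\}^{-1}$. So $\kappa\{\rho,\beta,\hat\alpha(\beta)\}=\min_{\alpha\in(0,1)}\kappa(\rho,\beta,\alpha)$. Exponential tilt mixture (ETM) model: sample $j$ is drawn from $dP_j=(1-\rho_j)dG_0+\rho_j\,dG_1$, with $dG_1/dG_0=\exp(\beta_0+\beta_1^{T}x)$ and $G_0$ an unspecified probability distribution. Its average profile log-likelihood of $(\rho,\beta)$ is the maximum of $\frac1N\sum_{j,i}[\log\{1-\rho_j+\rho_j\exp(\beta_0+\beta_1^Tx_{ji})\}+\log G_0(\{x_{ji}\})]$ over probability measures $G_0$ supported on the pooled data with $\int\exp(\beta_0+\beta_1^Tx)\,dG_0=1$; it is given by $\kappa\{\rho,\beta,\hat\alpha(\beta)\}$. Semi-supervised logistic regression (SLR) model: the sample label $z\in\{1,2,3\}$ given $x$ has probabilities $P(z=j|x)=\frac{n_j}{N}\,\frac{1-\rho_j+\rho_j\exp(\beta_0+\beta_1^{T}x)}{1-\tilde\alpha(\rho)+\tilde\alpha(\rho)\exp(\beta_0+\beta_1^{T}x)}$, $j=1,2,3$. Its average log-likelihood, up to an additive constant free of $(\rho,\beta)$, is $\kappa\{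\rho,\beta,\tilde\alpha(\rho)\}$.
   Formalization: A minimizer of κ over α in (0,1) need not exist (e.g. when every exp(β0+β1^T x_ji) exceeds 1), so κ{ρ,β,α̂(β)} is taken as a function only on those (ρ,β) where one exists, and its local and global maximizers are relative to that set. *)

theory Defs
  imports "HOL-Analysis.Analysis"
begin

text \<open>
  The coefficient vector \<open>\<beta> = (\<beta>0, \<beta>1)\<close> in \<open>\<real>\<^sup>1\<^sup>+\<^sup>p\<close> is a pair of type
  \<open>real \<times> (real ^ 'p)\<close>.  Sample sizes are \<open>n j\<close> and observations \<open>x j i\<close>; only \<open>j \<in> {1, 2, 3}\<close> and \<open>i \<in> {1..n j}\<close> are used.
\<close>

definition tilt :: "real \<times> (real ^ 'p) \<Rightarrow> real ^ 'p \<Rightarrow> real" where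
  "tilt \<beta> y = exp (fst \<beta> + snd \<beta> \<bullet> y)"

definition mix_prop :: "real \<Rightarrow> nat \<Rightarrow> real" where
  "mix_prop \<rho> j = (if j = 1 then 0 else if j = 2 then 1 else \<rho>)"

definition total_size :: "(nat \<Rightarrow> nat) \<Rightarrow> nat" where
  "total_size n = n 1 + n 2 + n 3"

definition kappa ::
  "(nat \<Rightarrow> nat) \<Rightarrow> (nat \<Rightarrow> nat \<Rightarrow> real ^ 'p) \<Rightarrow> real \<Rightarrow> real \<times> (real ^ 'p) \<Rightarrow> real \<Rightarrow> real" where
  "kappa n x \<rho> \<beta> \<alpha> =
     1 / real (total_size n) *
       (\<Sum>j=1..3. \<Sum>i=1..n j.
          ln ((1 - mix_prop \<rho> j + mix_prop \<rho> j * tilt \<beta> (x j i)) /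
              (1 - \<alpha> + \<alpha> * tilt \<beta> (x j i))))
     - ln (real (total_size n))"

definition alpha_tilde :: "(nat \<Rightarrow> nat) \<Rightarrow> real \<Rightarrow> real" where
  "alpha_tilde n \<rho> = (real (n 2) + real (n 3) * \<rho>) / real (total_size n)"

definition kappa_minimizer ::
  "(nat \<Rightarrow> nat) \<Rightarrow> (nat \<Rightarrow> nat \<Rightarrow> real ^ 'p) \<Rightarrow> real \<Rightarrow> real \<times> (real ^ 'p) \<Rightarrow> real \<Rightarrow> bool" where
  "kappa_minimizer n x \<rho> \<beta> a \<longleftrightarrow> is_arg_min (kappa n x \<rho> \<beta>) (\<lambda>\<alpha>. 0 < \<alpha> \<and> \<alpha> < 1) a"

definition slr_domain :: "(real \<times> (real \<times> (real ^ 'p))) set" where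
  "slr_domain = {0<..<1} \<times> UNIV"

text \<open>
  A minimizer over the open interval \<open>(0, 1)\<close> need not exist: for instance, if all tilts exceed \<open>1\<close>,
  then \<open>kappa\<close> is strictly decreasing in \<open>\<alpha>\<close>.  The profile function is therefore a partial
  function with the domain below.  Off this domain no distribution \<open>G\<^sub>0\<close> charging every
  observation satisfies \<open>\<integral> exp (\<beta>0 + \<beta>1 \<bullet> y) dG\<^sub>0(y) = 1\<close>, so that the profile log-likelihood is
  \<open>-\<infinity>\<close> there; restricting to the domain and using the value \<open>-\<infinity>\<close> outside it give
  the same local and global maximizers.
\<close>

definition etm_domain ::
  "(nat \<Rightarrow> nat) \<Rightarrow> (nat \<Rightarrow> nat \<Rightarrow> real ^ 'p) \<Rightarrow> (real \<times> (real \<times> (real ^ 'p))) set" where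
  "etm_domain n x = {(\<rho>, \<beta>). 0 < \<rho> \<and> \<rho> < 1 \<and> (\<exists>a. kappa_minimizer n x \<rho> \<beta> a)}"

definition global_maximizer_on :: "'a set \<Rightarrow> ('a \<Rightarrow> real) \<Rightarrow> 'a \<Rightarrow> bool" where
  "global_maximizer_on D f \<theta> \<longleftrightarrow> \<theta> \<in> D \<and> (\<forall>\<eta>\<in>D. f \<eta> \<le> f \<theta>)"

definition local_maximizer_on :: "'a::metric_space set \<Rightarrow> ('a \<Rightarrow> real) \<Rightarrow> 'a \<Rightarrow> bool" where
  "local_maximizer_on D f \<theta> \<longleftrightarrow>
     \<theta> \<in> D \<and> (\<exists>\<epsilon>>0. \<forall>\<eta>\<in>D. dist \<eta> \<theta> < \<epsilon> \<longrightarrow> f \<eta> \<le> f \<theta>)"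

lemma tilt_pos: "tilt \<beta> y > 0"
  by (simp add: tilt_def)

lemma convex_comb_tilt_pos:
  assumes "0 \<le> a" "a \<le> 1"
  shows "1 - a + a * tilt \<beta> y > 0"
proof (cases "a = 0")
  case False
  then have "a * tilt \<beta> y > 0" using assms tilt_pos[of \<beta> y] by simp
  then show ?thesis using assms by linarith
qed simp

lemma kappa_separates:
  assumes "0 < \<rho>" "\<rho> < 1" "0 < \<alpha>" "\<alpha> < 1"
  shows "kappa n x \<rho> \<beta> \<alpha> =
    1 / real (total_size n) *
      (\<Sum>j=1..3. \<Sum>i=1..n j. ln (1 - mix_prop \<rho> j + mix_prop \<rho> j * tilt \<beta> (x j i)))
    - 1 / real (total_size n) * (\<Sum>j=1..3. \<Sum>i=1..n j. ln (1 - \<alpha> + \<alpha> * tilt \<beta> (x j i)))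
    - ln (real (total_size n))"
proof -
  have "ln ((1 - mix_prop \<rho> j + mix_prop \<rho> j * tilt \<beta> (x j i)) / (1 - \<alpha> + \<alpha> * tilt \<beta> (x j i)))
      = ln (1 - mix_prop \<rho> j + mix_prop \<rho> j * tilt \<beta> (x j i)) - ln (1 - \<alpha> + \<alpha> * tilt \<beta> (x j i))"
    for j i
  proof -
    have "0 \<le> mix_prop \<rho> j" "mix_prop \<rho> j \<le> 1"
      using assms by (auto simp: mix_prop_def)
    then have "1 - mix_prop \<rho> j + mix_prop \<rho> j * tilt \<beta> (x j i) > 0"
      by (rule convex_comb_tilt_pos)
    moreover have "1 - \<alpha> + \<alpha> * tilt \<beta> (x j i) > 0"
      using assms by (intro convex_comb_tilt_pos) auto
    ultimately show ?thesis by (simp add: ln_div)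
  qed
  then show ?thesis
    by (simp only: kappa_def sum_subtractf right_diff_distrib)
qed

text \<open>The minimizers in \<open>\<alpha>\<close> do not depend on \<open>\<rho>\<close>, so they can be selected as a function of \<open>\<beta>\<close> alone.\<close>

lemma kappa_minimizer_free_of_rho:
  assumes "0 < \<rho>" "\<rho> < 1" "0 < \<rho>'" "\<rho>' < 1" "kappa_minimizer n x \<rho> \<beta> a"
  shows "kappa_minimizer n x \<rho>' \<beta> a"
  using assms by (auto simp: kappa_minimizer_def is_arg_min_def kappa_separates)

lemma ex_alpha_hat:
  "\<exists>alpha_hat. \<forall>\<rho> \<beta>. (\<rho>, \<beta>) \<in> etm_domain n x \<longrightarrow> kappa_minimizer n x \<rho> \<beta> (alpha_hat \<beta>)"
proof (intro exI allI impI)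
  fix \<rho> \<beta> assume "(\<rho>, \<beta>) \<in> etm_domain n x"
  then have r: "0 < \<rho>" "\<rho> < 1" and ex: "\<exists>a. kappa_minimizer n x \<rho> \<beta> a"
    by (auto simp: etm_domain_def)
  obtain a where a: "kappa_minimizer n x \<rho> \<beta> a" using ex ..
  have "kappa_minimizer n x (1/2) \<beta> a"
    by (rule kappa_minimizer_free_of_rho[OF r _ _ a]) simp_all
  then have "\<exists>a. kappa_minimizer n x (1/2) \<beta> a" ..
  then have "kappa_minimizer n x (1/2) \<beta> (SOME a. kappa_minimizer n x (1/2) \<beta> a)"
    by (rule someI_ex)
  then show "kappa_minimizer n x \<rho> \<beta> (SOME a. kappa_minimizer n x (1/2) \<beta> a)"
    by (rule kappa_minimizer_free_of_rho[rotated 4]) (use r in simp_all)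
qed

end

theory Submission imports Defs begin

text \<open>
  Multiplying the odds of \<open>\<rho>\<close> and \<open>\<alpha>\<close> by \<open>s > 0\<close> while dividing all tilts by \<open>s\<close> changes
  \<open>kappa\<close> only by a term that is explicit in \<open>s, \<rho>, \<alpha>\<close>; at \<open>\<alpha> = alpha_tilde n \<rho>\<close> that term is
  nonnegative for every \<open>s\<close>, by concavity of the logarithm.  There is exactly one \<open>s\<close> for which
  the rescaled \<open>\<alpha>\<close> becomes stationary, hence minimizing, at the rescaled \<open>\<beta>\<close>.  So there is a
  continuous map \<open>q \<mapsto> q'\<close> into the ETM domain with \<open>SLR(q) \<le> ETM(q')\<close>, whereas \<open>ETM \<le> SLR\<close>
  holds trivially on the ETM domain.  Differentiating along curves of rescaled parameters shows
  that local maximizers of either function are fixed points of this map, and there both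
  functions agree.
\<close>

section \<open>Rescaling of odds and tilts\<close>

abbreviation blend :: "real \<Rightarrow> real \<Rightarrow> real" where
  "blend a t \<equiv> 1 - a + a * t"

text \<open>The odds \<open>a / (1 - a)\<close> are multiplied by \<open>s\<close>. This form has no
  division by \<open>1 - a\<close>, so for \<open>s > 0\<close> it also covers the endpoints 0 and
  1, the values of \<open>mix_prop\<close> in the first two samples.\<close>

definition odds_scale :: "real \<Rightarrow> real \<Rightarrow> real" where
  "odds_scale s a = a * s / blend a s"

definition intercept_shift :: "real \<Rightarrow> real \<times> (real ^ 'p) \<Rightarrow> real \<times> (real ^ 'p)" where
  "intercept_shift s \<beta> = (fst \<beta> - ln s, snd \<beta>)"

lemma blend_pos:
  assumes "0 \<le> a" "a \<le> 1" "0 < t"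
  shows "0 < blend a t"
proof (cases "a = 0")
  case False
  then have "0 < a * t" using assms by simp
  then show ?thesis using assms by linarith
qed simp

lemma blend_tilt_pos:
  assumes "0 < a" "a < 1"
  shows "0 < blend a (tilt \<beta> y)"
  using assms by (intro blend_pos) (auto simp: tilt_pos)

lemma odds_scale_bounds:
  assumes "0 < a" "a < 1" "0 < s"
  shows "0 < odds_scale s a" "odds_scale s a < 1"
  using assms blend_pos[of a s] by (auto simp: odds_scale_def field_simps)

lemma odds_scale_1 [simp]: "odds_scale 1 a = a"
  by (simp add: odds_scale_def)

text \<open>Lets any target value be written as a rescaled one, so that
  \<open>kappa_odds_scale\<close> applies to it.\<close>

lemma odds_scale_inverse:
  assumes "0 < a" "a < 1" "0 < s"
  shows "odds_scale s (odds_scale (1 / s) a) = a"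
proof -
  define u where "u = a + s * (1 - a)"
  have u: "0 < u" using assms by (simp add: u_def add_pos_pos)
  have "blend a (1 / s) = u / s"
    using assms by (simp add: u_def field_simps)
  then have "odds_scale (1 / s) a = a / u"
    using assms u by (simp add: odds_scale_def)
  moreover have "blend (a / u) s = (u - a + a * s) / u"
    using u by (simp add: field_simps)
  moreover have "u - a + a * s = s"
    by (simp add: u_def algebra_simps)
  ultimately show ?thesis
    using assms u by (simp add: odds_scale_def)
qed

lemma tilt_intercept_shift:
  assumes "0 < s"
  shows "tilt (intercept_shift s \<beta>) y = tilt \<beta> y / s"
  using assms by (simp add: tilt_def intercept_shift_def exp_diff exp_add)

text \<open>The factor \<open>s\<close> in the new odds cancels the \<open>1 / s\<close> in the new
  tilt; what remains is the normalizer of \<open>odds_scale\<close>, which is free of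
  \<open>y\<close>.\<close>

lemma blend_odds_scale_tilt:
  assumes "0 \<le> a" "a \<le> 1" "0 < s"
  shows "blend (odds_scale s a) (tilt (intercept_shift s \<beta>) y) = blend a (tilt \<beta> y) / blend a s"
proof -
  define u where "u = blend a s"
  have u: "0 < u" using assms by (simp add: u_def blend_pos)
  have "blend (a * s / u) (tilt \<beta> y / s) = (u - a * s + a * tilt \<beta> y) / u"
    using u assms by (simp add: field_simps)
  then show ?thesis
    using assms by (simp add: odds_scale_def tilt_intercept_shift u_def)
qed

lemma intercept_shift_1 [simp]: "intercept_shift 1 \<beta> = \<beta>"
  by (simp add: intercept_shift_def)

text \<open>Odds 0 and infinity are fixed under scaling, so the known proportions of the first two
  samples survive and only the third moves.\<close>

lemma mix_prop_odds_scale: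
  assumes "0 < s"
  shows "mix_prop (odds_scale s \<rho>) j = odds_scale s (mix_prop \<rho> j)"
  using assms by (simp add: mix_prop_def odds_scale_def)

lemma isCont_rescaling_1: "isCont (\<lambda>s. (odds_scale s \<rho>, intercept_shift s \<beta>)) 1"
  unfolding odds_scale_def intercept_shift_def
  by (intro continuous_intros isCont_ln) simp_all

text \<open>On the log-odds scale the map adds \<open>ln s\<close>; the factor
  \<open>g z * (1 - g z)\<close> is the derivative of the inverse logit.\<close>

lemma has_real_derivative_odds_scale:
  assumes f: "(f has_real_derivative d) (at z)" and g: "(g has_real_derivative e) (at z)"
    and "f z = 1"
  shows "((\<lambda>w. odds_scale (f w) (g w)) has_real_derivative g z * (1 - g z) * d + e) (at z)"
  unfolding odds_scale_def
  by (rule derivative_eq_intros f g refl | simp add: assms(3) algebra_simps)+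

text \<open>Fermat's rule along a curve. It suits the ETM domain, which is not open: it contains
  \<open>\<beta> = 0\<close>, but no positive shift of that intercept alone. The objective itself
  need not be smooth, only its values \<open>\<phi>\<close> along the curve.\<close>

lemma local_maximizer_on_path_deriv_zero:
  fixes \<gamma> :: "real \<Rightarrow> 'a::metric_space"
  assumes max: "local_maximizer_on D F (\<gamma> z)" and cont: "isCont \<gamma> z"
    and ev: "\<forall>\<^sub>F w in nhds z. \<gamma> w \<in> D \<and> F (\<gamma> w) = \<phi> w"
    and deriv: "(\<phi> has_real_derivative l) (at z)"
  shows "l = 0"
proof -
  obtain \<epsilon> where "0 < \<epsilon>" and \<epsilon>: "\<And>\<eta>. \<eta> \<in> D \<Longrightarrow> dist \<eta> (\<gamma> z) < \<epsilon> \<Longrightarrow> F \<eta> \<le> F (\<gamma> z)"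
    using max unfolding local_maximizer_on_def by blast
  obtain \<delta> where "0 < \<delta>" and \<delta>: "\<And>w. dist w z < \<delta> \<Longrightarrow> dist (\<gamma> w) (\<gamma> z) < \<epsilon>"
    using cont \<open>0 < \<epsilon>\<close> by (metis continuous_at_eps_delta)
  obtain \<delta>' where "0 < \<delta>'" and \<delta>': "\<And>w. dist w z < \<delta>' \<Longrightarrow> \<gamma> w \<in> D \<and> F (\<gamma> w) = \<phi> w"
    using ev unfolding eventually_nhds_metric by blast
  have "\<forall>w. \<bar>z - w\<bar> < min \<delta> \<delta>' \<longrightarrow> \<phi> w \<le> \<phi> z"
    using \<epsilon> \<delta> \<delta>' \<open>0 < \<delta>'\<close> by (metis abs_minus_commute dist_real_def dist_self min_less_iff_conj)
  then show ?thesis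
    using DERIV_local_max[OF deriv] \<open>0 < \<delta>\<close> \<open>0 < \<delta>'\<close> by (metis min_less_iff_conj)
qed

text \<open>Minimizers may differ: if the tilts of all observations are 1, \<open>kappa\<close> is
  constant in \<open>\<alpha>\<close>.\<close>

lemma kappa_minimizers_equal:
  assumes "kappa_minimizer n x \<rho> \<beta> a" "kappa_minimizer n x \<rho> \<beta> b"
  shows "kappa n x \<rho> \<beta> a = kappa n x \<rho> \<beta> b"
  using assms by (intro order_antisym) (simp_all add: kappa_minimizer_def is_arg_min_linorder)

section \<open>Averages over the pooled sample\<close>

locale three_samples =
  fixes n :: "nat \<Rightarrow> nat" and x :: "nat \<Rightarrow> nat \<Rightarrow> real ^ 'p"
  assumes sizes: "n 1 \<ge> 1" "n 2 \<ge> 1" "n 3 \<ge> 1"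
begin

abbreviation "N \<equiv> real (total_size n)"

lemma N_pos: "0 < N"
  using sizes by (simp add: total_size_def)

lemma sum_samples: "(\<Sum>j=1..3::nat. F j) = F 1 + F 2 + (F 3 :: real)"
  by (simp add: eval_nat_numeral)

definition pooled_mean :: "(real ^ 'p \<Rightarrow> real) \<Rightarrow> real" where
  "pooled_mean \<phi> = (\<Sum>j=1..3. \<Sum>i=1..n j. \<phi> (x j i)) / N"

lemma pooled_mean_const [simp]: "pooled_mean (\<lambda>y. c) = c"
  using N_pos unfolding pooled_mean_def sum_samples
  by (simp add: field_simps) (simp add: total_size_def algebra_simps)

lemma pooled_mean_add: "pooled_mean (\<lambda>y. \<phi> y + \<psi> y) = pooled_mean \<phi> + pooled_mean \<psi>"
  by (simp add: pooled_mean_def sum.distrib add_divide_distrib)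

lemma pooled_mean_diff: "pooled_mean (\<lambda>y. \<phi> y - \<psi> y) = pooled_mean \<phi> - pooled_mean \<psi>"
  by (simp add: pooled_mean_def sum_subtractf diff_divide_distrib)

lemma pooled_mean_cmult: "pooled_mean (\<lambda>y. c * \<phi> y) = c * pooled_mean \<phi>"
  by (simp add: pooled_mean_def sum_distrib_left)

lemma pooled_mean_mono: "(\<And>y. \<phi> y \<le> \<psi> y) \<Longrightarrow> pooled_mean \<phi> \<le> pooled_mean \<psi>"
  unfolding pooled_mean_def using N_pos by (intro divide_right_mono sum_mono) auto

lemma pooled_mean_pos:
  assumes "\<And>y. 0 < \<phi> y"
  shows "0 < pooled_mean \<phi>"
proof -
  have "0 < (\<Sum>i=1..n j. \<phi> (x j i))" if "n j \<ge> 1" for j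
    using that assms by (intro sum_pos) auto
  then show ?thesis
    using N_pos sizes unfolding pooled_mean_def sum_samples by (simp add: add_pos_pos)
qed

lemma pooled_mean_nonneg_eq_0:
  assumes "pooled_mean \<phi> = 0" "\<And>y. 0 \<le> \<phi> y" "j \<in> {1..3}" "i \<in> {1..n j}"
  shows "\<phi> (x j i) = 0"
proof -
  have "(\<Sum>j=1..3. \<Sum>i=1..n j. \<phi> (x j i)) = 0"
    using assms(1) N_pos by (simp add: pooled_mean_def)
  then have "(\<Sum>i=1..n j. \<phi> (x j i)) = 0"
    using assms(2,3) by (subst (asm) sum_nonneg_eq_0_iff) (auto intro: sum_nonneg)
  then show ?thesis
    using assms(2,4) by (subst (asm) sum_nonneg_eq_0_iff) auto
qed

lemma pooled_mean_cong:
  assumes "\<And>j i. j \<in> {1..3} \<Longrightarrow> i \<in> {1..n j} \<Longrightarrow> \<phi> (x j i) = \<psi> (x j i)"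
  shows "pooled_mean \<phi> = pooled_mean \<psi>"
  unfolding pooled_mean_def using assms by (auto intro!: arg_cong2[where f = "(/)"] sum.cong)

lemma has_real_derivative_pooled_mean:
  assumes "\<And>y. ((\<lambda>w. \<phi> w y) has_real_derivative \<phi>' y) (at z)"
  shows "((\<lambda>w. pooled_mean (\<phi> w)) has_real_derivative pooled_mean \<phi>') (at z)"
  unfolding pooled_mean_def by (intro DERIV_cdivide DERIV_sum assms)

section \<open>Stationarity of \<open>kappa\<close> in \<open>\<alpha>\<close>\<close>

text \<open>The side of the stationarity condition for \<open>\<alpha>\<close> that has to equal
  1.\<close>

definition mean_inverse :: "real \<times> (real ^ 'p) \<Rightarrow> real \<Rightarrow> real" where
  "mean_inverse \<beta> a = pooled_mean (\<lambda>y. 1 / blend a (tilt \<beta> y))"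

lemma mean_inverse_pos:
  assumes "0 < a" "a < 1"
  shows "0 < mean_inverse \<beta> a"
  unfolding mean_inverse_def using blend_tilt_pos[OF assms] by (intro pooled_mean_pos) simp

text \<open>With \<open>u = blend a t\<close>, the substitution \<open>t - 1 = (u - 1) / a\<close>
  expresses the slope through \<open>1 / u\<close>. Where \<open>mean_inverse\<close> is 1, the
  numerator is the empirical variance of \<open>1 / u\<close>.\<close>

lemma has_real_derivative_mean_inverse:
  assumes "0 < a" "a < 1"
  shows "(mean_inverse \<beta> has_real_derivative
    (pooled_mean (\<lambda>y. (1 / blend a (tilt \<beta> y))\<^sup>2) - mean_inverse \<beta> a) / a) (at a)"
proof -
  have "((\<lambda>a. 1 / blend a (tilt \<beta> y)) has_real_derivative
      1 / a * ((1 / blend a (tilt \<beta> y))\<^sup>2 - 1 / blend a (tilt \<beta> y))) (at a)" for y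
  proof -
    define u where "u = blend a (tilt \<beta> y)"
    have u: "0 < u" using blend_tilt_pos[OF assms] by (simp add: u_def)
    have "((\<lambda>a. 1 / blend a (tilt \<beta> y)) has_real_derivative - (tilt \<beta> y - 1) / u\<^sup>2) (at a)"
      using u by (auto intro!: derivative_eq_intros simp: u_def power2_eq_square)
    moreover have t: "tilt \<beta> y - 1 = (u - 1) / a"
      using assms by (simp add: u_def field_simps)
    have "- (tilt \<beta> y - 1) / u\<^sup>2 = 1 / a * ((1 / u)\<^sup>2 - 1 / u)"
      unfolding t using assms u by (simp add: field_simps power2_eq_square)
    ultimately show ?thesis by (simp only: u_def)
  qed
  then have "((\<lambda>a. mean_inverse \<beta> a) has_real_derivative
      pooled_mean (\<lambda>y. 1 / a * ((1 / blend a (tilt \<beta> y))\<^sup>2 - 1 / blend a (tilt \<beta> y)))) (at a)"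
    unfolding mean_inverse_def by (rule has_real_derivative_pooled_mean)
  then show ?thesis
    unfolding pooled_mean_cmult pooled_mean_diff mean_inverse_def[symmetric] by simp
qed

lemma kappa_eq_pooled_mean:
  assumes "0 < \<rho>" "\<rho> < 1" "0 < a" "a < 1"
  shows "kappa n x \<rho> \<beta> a =
    (\<Sum>j=1..3. \<Sum>i=1..n j. ln (blend (mix_prop \<rho> j) (tilt \<beta> (x j i)))) / N
      - pooled_mean (\<lambda>y. ln (blend a (tilt \<beta> y))) - ln N"
  using assms by (simp add: kappa_separates pooled_mean_def)

lemma has_real_derivative_kappa:
  assumes "0 < \<rho>" "\<rho> < 1" "0 < a" "a < 1"
  shows "(kappa n x \<rho> \<beta> has_real_derivative (mean_inverse \<beta> a - 1) / a) (at a)"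
proof -
  have "((\<lambda>a. ln (blend a (tilt \<beta> y))) has_real_derivative
      1 / a * (1 - 1 / blend a (tilt \<beta> y))) (at a)" for y
  proof -
    define u where "u = blend a (tilt \<beta> y)"
    have u: "0 < u" using blend_tilt_pos[OF assms(3,4)] by (simp add: u_def)
    have "((\<lambda>a. ln (blend a (tilt \<beta> y))) has_real_derivative (tilt \<beta> y - 1) / u) (at a)"
      using u by (auto intro!: derivative_eq_intros simp: u_def)
    moreover have t: "tilt \<beta> y - 1 = (u - 1) / a"
      using assms by (simp add: u_def field_simps)
    have "(tilt \<beta> y - 1) / u = 1 / a * (1 - 1 / u)"
      unfolding t using assms u by (simp add: field_simps)
    ultimately show ?thesis by (simp only: u_def)
  qed
  then have "((\<lambda>a. pooled_mean (\<lambda>y. ln (blend a (tilt \<beta> y)))) has_real_derivative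
      pooled_mean (\<lambda>y. 1 / a * (1 - 1 / blend a (tilt \<beta> y)))) (at a)"
    by (rule has_real_derivative_pooled_mean)
  then have "((\<lambda>a. (\<Sum>j=1..3. \<Sum>i=1..n j. ln (blend (mix_prop \<rho> j) (tilt \<beta> (x j i)))) / N
      - pooled_mean (\<lambda>y. ln (blend a (tilt \<beta> y))) - ln N) has_real_derivative
      0 - 1 / a * (1 - mean_inverse \<beta> a) - 0) (at a)"
    unfolding pooled_mean_cmult pooled_mean_diff pooled_mean_const mean_inverse_def[symmetric]
    by (intro DERIV_diff DERIV_const)
  then have "(kappa n x \<rho> \<beta> has_real_derivative 0 - 1 / a * (1 - mean_inverse \<beta> a) - 0) (at a)"
    \<comment> \<open>The separated form of \<open>kappa\<close> is available only for
      \<open>a\<close> in \<open>(0, 1)\<close>, hence the transfer on that open interval.\<close>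
    by (rule has_field_derivative_transform_within_open[where S = "{0<..<1}"])
       (use assms in \<open>auto simp: kappa_eq_pooled_mean\<close>)
  then show ?thesis
    by (simp add: diff_divide_distrib)
qed

text \<open>An interior minimum has derivative 0. Conversely, \<open>ln z \<le> z - 1\<close> at the
  ratio of the blends bounds each log difference by an affine function of
  \<open>1 / blend a t\<close>, whose pooled mean is 0 once \<open>mean_inverse\<close> is
  1.\<close>

lemma kappa_minimizer_iff:
  assumes "0 < \<rho>" "\<rho> < 1"
  shows "kappa_minimizer n x \<rho> \<beta> a \<longleftrightarrow> 0 < a \<and> a < 1 \<and> mean_inverse \<beta> a = 1"
proof (intro iffI conjI; (elim conjE)?)
  assume min: "kappa_minimizer n x \<rho> \<beta> a"
  then show a: "0 < a" "a < 1"
    by (auto simp: kappa_minimizer_def is_arg_min_def)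
  have "0 < b \<and> b < 1" if "\<bar>a - b\<bar> < min a (1 - a)" for b
    using that by linarith
  then have "\<forall>b. \<bar>a - b\<bar> < min a (1 - a) \<longrightarrow> kappa n x \<rho> \<beta> a \<le> kappa n x \<rho> \<beta> b"
    using min unfolding kappa_minimizer_def is_arg_min_linorder by blast
  then have "(mean_inverse \<beta> a - 1) / a = 0"
    using DERIV_local_min[OF has_real_derivative_kappa[OF assms a], of "min a (1 - a)"] a by simp
  then show "mean_inverse \<beta> a = 1"
    using a by simp
next
  assume a: "0 < a" "a < 1" and one: "mean_inverse \<beta> a = 1"
  have "kappa n x \<rho> \<beta> a \<le> kappa n x \<rho> \<beta> b" if b: "0 < b" "b < 1" for b
  proof -
    have "ln (blend b (tilt \<beta> y)) - ln (blend a (tilt \<beta> y))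
        \<le> b / a + (1 - b / a) * (1 / blend a (tilt \<beta> y)) - 1" for y
    proof -
      note pos = blend_tilt_pos[OF a, of \<beta> y] blend_tilt_pos[OF b, of \<beta> y]
      have "ln (blend b (tilt \<beta> y)) - ln (blend a (tilt \<beta> y)) = ln (blend b (tilt \<beta> y) / blend a (tilt \<beta> y))"
        using pos by (simp add: ln_div)
      also have "\<dots> \<le> blend b (tilt \<beta> y) / blend a (tilt \<beta> y) - 1"
        using pos by (intro ln_le_minus_one) simp
      also have "\<dots> = b / a + (1 - b / a) * (1 / blend a (tilt \<beta> y)) - 1"
      proof -
        define u where "u = blend a (tilt \<beta> y)"
        have "0 < u" using pos by (simp add: u_def)
        have t: "blend b (tilt \<beta> y) = 1 + b / a * (u - 1)"
          using a by (simp add: u_def field_simps)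
        have "blend b (tilt \<beta> y) / u = b / a + (1 - b / a) * (1 / u)"
          unfolding t using \<open>0 < u\<close> a by (simp add: field_simps)
        then show ?thesis by (simp only: u_def)
      qed
      finally show ?thesis .
    qed
    then have "pooled_mean (\<lambda>y. ln (blend b (tilt \<beta> y)) - ln (blend a (tilt \<beta> y)))
        \<le> pooled_mean (\<lambda>y. b / a + (1 - b / a) * (1 / blend a (tilt \<beta> y)) - 1)"
      by (rule pooled_mean_mono)
    also have "\<dots> = 0"
      unfolding pooled_mean_diff pooled_mean_add pooled_mean_cmult pooled_mean_const
        mean_inverse_def[symmetric] one by simp
    finally show ?thesis
      using assms a b by (simp add: kappa_eq_pooled_mean pooled_mean_diff)
  qed
  then show "kappa_minimizer n x \<rho> \<beta> a"
    using a by (auto simp: kappa_minimizer_def is_arg_min_linorder)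
qed

section \<open>Effect of rescaling on \<open>kappa\<close>, and the balancing factor\<close>

text \<open>Each normalizer left by \<open>blend_odds_scale_tilt\<close> is constant within a
  sample. For the numerators they are \<open>blend 0 s = 1\<close>, \<open>blend 1 s = s\<close> and
  \<open>blend \<rho> s\<close>, so sample 1 contributes nothing to the subtracted term.\<close>

lemma kappa_odds_scale:
  assumes "0 < \<rho>" "\<rho> < 1" "0 < a" "a < 1" "0 < s"
  shows "kappa n x (odds_scale s \<rho>) (intercept_shift s \<beta>) (odds_scale s a) =
    kappa n x \<rho> \<beta> a + ln (blend a s) - (real (n 2) * ln s + real (n 3) * ln (blend \<rho> s)) / N"
proof -
  have "ln (blend (mix_prop (odds_scale s \<rho>) j) (tilt (intercept_shift s \<beta>) (x j i)) /
        blend (odds_scale s a) (tilt (intercept_shift s \<beta>) (x j i))) =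
      ln (blend (mix_prop \<rho> j) (tilt \<beta> (x j i)) / blend a (tilt \<beta> (x j i)))
        + (ln (blend a s) - ln (blend (mix_prop \<rho> j) s))" for j i
  proof -
    have m: "0 \<le> mix_prop \<rho> j" "mix_prop \<rho> j \<le> 1"
      using assms by (auto simp: mix_prop_def)
    have pos: "0 < blend (mix_prop \<rho> j) (tilt \<beta> (x j i))" "0 < blend (mix_prop \<rho> j) s"
        "0 < blend a (tilt \<beta> (x j i))" "0 < blend a s"
      using m assms tilt_pos[of \<beta> "x j i"] by (auto intro!: blend_pos)
    then show ?thesis
      using assms m by (simp add: mix_prop_odds_scale blend_odds_scale_tilt ln_div ln_mult)
  qed
  then have "kappa n x (odds_scale s \<rho>) (intercept_shift s \<beta>) (odds_scale s a) = kappa n x \<rho> \<beta> a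
      + 1 / N * (\<Sum>j=1..3. \<Sum>i=1..n j. ln (blend a s) - ln (blend (mix_prop \<rho> j) s))"
    by (simp add: kappa_def sum.distrib distrib_left)
  also have "(\<Sum>j=1..3. \<Sum>i=1..n j. ln (blend a s) - ln (blend (mix_prop \<rho> j) s))
      = N * ln (blend a s) - (real (n 2) * ln s + real (n 3) * ln (blend \<rho> s))"
    unfolding sum_samples by (simp add: mix_prop_def total_size_def algebra_simps)
  finally show ?thesis
    using N_pos by (simp add: field_simps)
qed

lemma alpha_tilde_bounds:
  assumes "0 < \<rho>" "\<rho> < 1"
  shows "0 < alpha_tilde n \<rho>" "alpha_tilde n \<rho> < 1"
proof -
  have "real (n 3) * \<rho> < real (n 3)" "0 < real (n 3) * \<rho>" "0 < real (n 1)"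
    using assms sizes by auto
  then have "0 < real (n 2) + real (n 3) * \<rho>" "real (n 2) + real (n 3) * \<rho> < N"
    unfolding total_size_def by linarith+
  then show "0 < alpha_tilde n \<rho>" "alpha_tilde n \<rho> < 1"
    using N_pos by (simp_all add: alpha_tilde_def)
qed

text \<open>Since \<open>blend (alpha_tilde n \<rho>) s\<close> is the average of \<open>1\<close>, \<open>s\<close>, \<open>blend \<rho> s\<close> with weights
  proportional to the sample sizes, this is the concavity of the logarithm.\<close>

lemma kappa_alpha_tilde_le:
  assumes "0 < \<rho>" "\<rho> < 1" "0 < s"
  shows "kappa n x \<rho> \<beta> (alpha_tilde n \<rho>) \<le>
    kappa n x (odds_scale s \<rho>) (intercept_shift s \<beta>) (odds_scale s (alpha_tilde n \<rho>))"
proof -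
  define u where "u = blend (alpha_tilde n \<rho>) s"
  note a = alpha_tilde_bounds[OF assms(1,2)]
  have u: "0 < u" and r: "0 < blend \<rho> s"
    unfolding u_def using a assms by (auto intro!: blend_pos)
  \<comment> \<open>All three logarithms are bounded by the tangent at their common weighted mean
    \<open>u\<close>, so the linear parts cancel in the sum.\<close>
  have tangent: "ln z - ln u \<le> z / u - 1" if "0 < z" for z
    using ln_le_minus_one[of "z / u"] that u by (simp add: ln_div)
  have "real (n 1) * (ln 1 - ln u) + real (n 2) * (ln s - ln u) + real (n 3) * (ln (blend \<rho> s) - ln u)
      \<le> real (n 1) * (1 / u - 1) + real (n 2) * (s / u - 1) + real (n 3) * (blend \<rho> s / u - 1)"
    using assms r by (intro add_mono mult_left_mono tangent) auto
  also have "\<dots> = (real (n 1) + real (n 2) * s + real (n 3) * blend \<rho> s) / u - N"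
    using u by (simp add: total_size_def field_simps)
  also have "real (n 1) + real (n 2) * s + real (n 3) * blend \<rho> s = N * u"
    using N_pos by (simp add: u_def alpha_tilde_def field_simps) (simp add: total_size_def algebra_simps)
  also have "N * u / u - N = 0"
    using u by simp
  finally have "real (n 2) * ln s + real (n 3) * ln (blend \<rho> s) \<le> N * ln u"
    by (simp add: total_size_def algebra_simps)
  then have "(real (n 2) * ln s + real (n 3) * ln (blend \<rho> s)) / N \<le> ln u"
    using N_pos by (simp add: field_simps)
  then show ?thesis
    unfolding kappa_odds_scale[OF assms(1,2) a assms(3)] u_def by linarith
qed

text \<open>The factor \<open>s\<close> solving \<open>blend a s * mean_inverse \<beta> a = 1\<close>, which makes the rescaled \<open>a\<close> stationary.\<close>

definition balancing :: "real \<times> (real ^ 'p) \<Rightarrow> real \<Rightarrow> real" where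
  "balancing \<beta> a = (1 / mean_inverse \<beta> a - (1 - a)) / a"

lemma blend_balancing:
  assumes "0 < a"
  shows "blend a (balancing \<beta> a) = 1 / mean_inverse \<beta> a"
  using assms by (simp add: balancing_def)

text \<open>Amounts to \<open>(1 - a) * mean_inverse \<beta> a < 1\<close>, which holds because
  every \<open>blend a t\<close> exceeds \<open>1 - a\<close> by \<open>a * t > 0\<close>.\<close>

lemma balancing_pos:
  assumes a: "0 < a" "a < 1"
  shows "0 < balancing \<beta> a"
proof -
  have "1 - (1 - a) * (1 / blend a (tilt \<beta> y)) > 0" for y
    using a tilt_pos[of \<beta> y] blend_tilt_pos[OF a, of \<beta> y] by (simp add: field_simps)
  then have "0 < pooled_mean (\<lambda>y. 1 - (1 - a) * (1 / blend a (tilt \<beta> y)))"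
    by (rule pooled_mean_pos)
  then have "0 < 1 - (1 - a) * mean_inverse \<beta> a"
    unfolding pooled_mean_diff pooled_mean_cmult pooled_mean_const mean_inverse_def .
  then show ?thesis
    using a mean_inverse_pos[OF a, of \<beta>] by (simp add: balancing_def field_simps)
qed

lemma balancing_eq_1:
  assumes "0 < a" "mean_inverse \<beta> a = 1"
  shows "balancing \<beta> a = 1"
  using assms by (simp add: balancing_def)

text \<open>Rescaling multiplies all \<open>1 / blend a t\<close> by \<open>blend a s\<close>, hence
  also their mean; the balancing factor makes the product 1. Here \<open>a\<close> is arbitrary in
  \<open>(0, 1)\<close>, which yields whole curves inside the ETM domain.\<close>

lemma kappa_minimizer_balanced:
  fixes \<beta> :: "real \<times> (real ^ 'p)" and a :: real
  defines "s \<equiv> balancing \<beta> a"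
  assumes \<rho>: "0 < \<rho>" "\<rho> < 1" and a: "0 < a" "a < 1"
  shows "kappa_minimizer n x (odds_scale s \<rho>) (intercept_shift s \<beta>) (odds_scale s a)"
    and "(odds_scale s \<rho>, intercept_shift s \<beta>) \<in> etm_domain n x"
proof -
  have s: "0 < s"
    using balancing_pos[OF a] by (simp add: s_def)
  have "1 / blend (odds_scale s a) (tilt (intercept_shift s \<beta>) y)
      = blend a s * (1 / blend a (tilt \<beta> y))" for y
    using a s by (simp add: blend_odds_scale_tilt)
  then have "mean_inverse (intercept_shift s \<beta>) (odds_scale s a) = blend a s * mean_inverse \<beta> a"
    by (simp only: mean_inverse_def pooled_mean_cmult)
  also have "\<dots> = 1"
    using mean_inverse_pos[OF a, of \<beta>] unfolding s_def blend_balancing[OF a(1)] by simp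
  finally show "kappa_minimizer n x (odds_scale s \<rho>) (intercept_shift s \<beta>) (odds_scale s a)"
    using \<rho> a s by (simp add: kappa_minimizer_iff odds_scale_bounds)
  then show "(odds_scale s \<rho>, intercept_shift s \<beta>) \<in> etm_domain n x"
    using \<rho> s by (auto simp: etm_domain_def odds_scale_bounds)
qed

section \<open>Stationarity at local maximizers of either function\<close>

text \<open>The curve rescales the point by \<open>s\<close> and passes through it at
  \<open>s = 1\<close>. The derivatives of the explicit terms cancel there, leaving
  \<open>(mean_inverse \<beta> a - 1) / a * d\<close> with \<open>d < 0\<close>.\<close>

lemma slr_local_maximizer_stationary:
  assumes max: "local_maximizer_on slr_domain
      (\<lambda>(\<rho>, \<beta>). kappa n x \<rho> \<beta> (alpha_tilde n \<rho>)) (\<rho>, \<beta>)"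
  shows "mean_inverse \<beta> (alpha_tilde n \<rho>) = 1"
proof -
  have \<rho>: "0 < \<rho>" "\<rho> < 1"
    using max by (auto simp: local_maximizer_on_def slr_domain_def)
  let ?a = "alpha_tilde n \<rho>"
  note a = alpha_tilde_bounds[OF \<rho>]
  define \<gamma> where "\<gamma> s = (odds_scale s \<rho>, intercept_shift s \<beta>)" for s
  \<comment> \<open>Chosen so that \<open>odds_scale s (b s)\<close> is \<open>alpha_tilde\<close>
    at the rescaled \<open>\<rho>\<close>; the SLR value on the curve is then explicit in
    \<open>\<rho>\<close>, \<open>\<beta>\<close> and \<open>s\<close>.\<close>
  define b where "b s = odds_scale (1 / s) (alpha_tilde n (odds_scale s \<rho>))" for s
  define \<phi> where "\<phi> s = kappa n x \<rho> \<beta> (b s) + ln (blend (b s) s)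
      - (real (n 2) * ln s + real (n 3) * ln (blend \<rho> s)) / N" for s
  define d where "d = real (n 3) / N * (\<rho> * (1 - \<rho>)) - ?a * (1 - ?a)"
  have b1: "b 1 = ?a"
    by (simp add: b_def)
  have "((\<lambda>s. alpha_tilde n (odds_scale s \<rho>)) has_real_derivative real (n 3) / N * (\<rho> * (1 - \<rho>))) (at 1)"
    unfolding alpha_tilde_def
    using N_pos by (auto intro!: derivative_eq_intros has_real_derivative_odds_scale)
  moreover have "((\<lambda>s. 1 / s) has_real_derivative -1) (at (1::real))"
    by (auto intro!: derivative_eq_intros)
  ultimately have "(b has_real_derivative
      alpha_tilde n (odds_scale 1 \<rho>) * (1 - alpha_tilde n (odds_scale 1 \<rho>)) * (-1)
        + real (n 3) / N * (\<rho> * (1 - \<rho>))) (at 1)"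
    unfolding b_def by (intro has_real_derivative_odds_scale) auto
  then have b: "(b has_real_derivative d) (at 1)"
    by (simp add: d_def)
  have "((\<lambda>s. kappa n x \<rho> \<beta> (b s)) has_real_derivative (mean_inverse \<beta> ?a - 1) / ?a * d) (at 1)"
    by (rule DERIV_chain2[OF _ b]) (simp only: b1 has_real_derivative_kappa[OF \<rho> a])
  \<comment> \<open>The slope of \<open>b\<close> enters with the factor \<open>s - 1\<close>, which
    vanishes at 1.\<close>
  moreover have "((\<lambda>s. ln (blend (b s) s)) has_real_derivative ?a) (at 1)"
    by (rule derivative_eq_intros b refl | simp add: b1)+
  moreover have "((\<lambda>s. (real (n 2) * ln s + real (n 3) * ln (blend \<rho> s)) / N) has_real_derivative ?a) (at 1)"
    using N_pos by (auto intro!: derivative_eq_intros simp: alpha_tilde_def field_simps)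
  ultimately have deriv: "(\<phi> has_real_derivative (mean_inverse \<beta> ?a - 1) / ?a * d + ?a - ?a) (at 1)"
    unfolding \<phi>_def by (intro DERIV_add DERIV_diff)
  have cont: "isCont \<gamma> 1"
    unfolding \<gamma>_def by (rule isCont_rescaling_1)
  have "\<gamma> s \<in> slr_domain \<and>
      (\<lambda>(\<rho>, \<beta>). kappa n x \<rho> \<beta> (alpha_tilde n \<rho>)) (\<gamma> s) = \<phi> s" if s: "0 < s" for s
  proof -
    note \<rho>' = odds_scale_bounds[OF \<rho> s]
    note a' = alpha_tilde_bounds[OF \<rho>']
    have "0 < b s" "b s < 1"
      using a' s by (simp_all add: b_def odds_scale_bounds)
    moreover have "odds_scale s (b s) = alpha_tilde n (odds_scale s \<rho>)"
      using a' s by (simp add: b_def odds_scale_inverse)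
    ultimately show ?thesis
      using kappa_odds_scale[OF \<rho> _ _ s, of "b s" \<beta>] \<rho>'
      by (simp add: \<gamma>_def \<phi>_def slr_domain_def)
  qed
  then have ev: "\<forall>\<^sub>F s in nhds 1. \<gamma> s \<in> slr_domain \<and>
      (\<lambda>(\<rho>, \<beta>). kappa n x \<rho> \<beta> (alpha_tilde n \<rho>)) (\<gamma> s) = \<phi> s"
    by (intro eventually_mono[OF eventually_nhds_in_open[of "{0<..}" 1]]) auto
  have "\<gamma> 1 = (\<rho>, \<beta>)"
    by (simp add: \<gamma>_def)
  then have "(mean_inverse \<beta> ?a - 1) / ?a * d + ?a - ?a = 0"
    using local_maximizer_on_path_deriv_zero[OF _ cont ev deriv] max by (simp only:)
  \<comment> \<open>Variance decomposition: \<open>-d\<close> is the variance of the three mixing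
    proportions under weights \<open>n j / N\<close>, total Bernoulli variance minus the
    within-sample part. It is positive since the proportions 0 and 1 both occur.\<close>
  moreover have "d < 0"
  proof -
    have "N\<^sup>2 * d = N * real (n 3) * (\<rho> * (1 - \<rho>))
        - (real (n 2) + real (n 3) * \<rho>) * (N - real (n 2) - real (n 3) * \<rho>)"
      using N_pos by (simp add: d_def alpha_tilde_def field_simps power2_eq_square)
    also have "\<dots> = - (real (n 2) * real (n 1) + real (n 2) * real (n 3) * (1 - \<rho>)\<^sup>2 + real (n 1) * real (n 3) * \<rho>\<^sup>2)"
      by (simp add: total_size_def algebra_simps power2_eq_square)
    also have "\<dots> < 0"
      using sizes \<rho> by (simp only: neg_less_0_iff_less) (intro add_pos_nonneg; simp)
    finally show ?thesis
      using N_pos by (simp add: mult_less_0_iff)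
  qed
  ultimately show ?thesis
    using a by simp
qed

text \<open>The curve is parametrized by the value \<open>c\<close> of \<open>\<alpha>\<close>
  before rescaling: the scale \<open>balancing \<beta> c\<close> is then explicit and keeps the
  curve in the domain. Its derivative condition is
  \<open>w * (a - alpha_tilde n \<rho>) = 0\<close>, with \<open>w\<close> the slope of the
  scale.\<close>

lemma etm_local_maximizer_stationary:
  assumes max: "local_maximizer_on (etm_domain n x)
      (\<lambda>(\<rho>, \<beta>). kappa n x \<rho> \<beta> (alpha_hat \<beta>)) (\<rho>, \<beta>)"
    and alpha_hat: "\<And>\<rho> \<beta>. (\<rho>, \<beta>) \<in> etm_domain n x \<Longrightarrow> kappa_minimizer n x \<rho> \<beta> (alpha_hat \<beta>)"
  shows "mean_inverse \<beta> (alpha_tilde n \<rho>) = 1"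
proof -
  have dom: "(\<rho>, \<beta>) \<in> etm_domain n x"
    using max by (simp add: local_maximizer_on_def)
  then have \<rho>: "0 < \<rho>" "\<rho> < 1"
    by (auto simp: etm_domain_def)
  define a where "a = alpha_hat \<beta>"
  have a: "0 < a" "a < 1" and one: "mean_inverse \<beta> a = 1"
    using alpha_hat[OF dom] \<rho> by (auto simp: kappa_minimizer_iff a_def)
  define v where "v = pooled_mean (\<lambda>y. (1 / blend a (tilt \<beta> y))\<^sup>2) - 1"
  define \<gamma> where "\<gamma> c = (odds_scale (balancing \<beta> c) \<rho>, intercept_shift (balancing \<beta> c) \<beta>)" for c
  define \<phi> where "\<phi> c = kappa n x \<rho> \<beta> c + ln (1 / mean_inverse \<beta> c)
      - (real (n 2) * ln (balancing \<beta> c) + real (n 3) * ln (blend \<rho> (balancing \<beta> c))) / N" for c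
  have bal1: "balancing \<beta> a = 1"
    using a one by (simp add: balancing_eq_1)
  have h: "(mean_inverse \<beta> has_real_derivative v / a) (at a)"
    using has_real_derivative_mean_inverse[OF a, of \<beta>] by (simp add: v_def one)
  define w where "w = - v / a\<^sup>2"
  have bal: "(balancing \<beta> has_real_derivative w) (at a)"
    unfolding balancing_def w_def
    by (rule derivative_eq_intros h refl | use a one in \<open>simp add: field_simps power2_eq_square\<close>)+
  have "(kappa n x \<rho> \<beta> has_real_derivative 0) (at a)"
    using has_real_derivative_kappa[OF \<rho> a, of \<beta>] one by simp
  moreover have "((\<lambda>c. ln (1 / mean_inverse \<beta> c)) has_real_derivative w * a) (at a)"
    unfolding w_def
    by (rule derivative_eq_intros h refl | use a one in \<open>simp add: field_simps power2_eq_square\<close>)+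
  moreover
  have "((\<lambda>c. (real (n 2) * ln (balancing \<beta> c) + real (n 3) * ln (blend \<rho> (balancing \<beta> c))) / N)
      has_real_derivative (real (n 2) * w + real (n 3) * (\<rho> * w)) / N) (at a)"
    by (intro DERIV_cdivide DERIV_add DERIV_cmult) (auto intro!: derivative_eq_intros bal simp: bal1)
  then have "((\<lambda>c. (real (n 2) * ln (balancing \<beta> c) + real (n 3) * ln (blend \<rho> (balancing \<beta> c))) / N)
      has_real_derivative w * alpha_tilde n \<rho>) (at a)"
    by (rule DERIV_cong) (simp add: alpha_tilde_def algebra_simps)
  ultimately have deriv: "(\<phi> has_real_derivative 0 + w * a - w * alpha_tilde n \<rho>) (at a)"
    unfolding \<phi>_def by (intro DERIV_add DERIV_diff)
  have cont: "isCont \<gamma> a"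
    unfolding \<gamma>_def
    by (rule isCont_o2[OF DERIV_isCont[OF bal], where g = "\<lambda>s. (odds_scale s \<rho>, intercept_shift s \<beta>)"])
       (simp only: bal1 isCont_rescaling_1)
  have "\<gamma> c \<in> etm_domain n x \<and> (\<lambda>(\<rho>, \<beta>). kappa n x \<rho> \<beta> (alpha_hat \<beta>)) (\<gamma> c) = \<phi> c"
    if c: "0 < c" "c < 1" for c
  proof -
    note bl = kappa_minimizer_balanced[OF \<rho> c, of \<beta>]
    \<comment> \<open>\<open>alpha_hat\<close> is just some minimizer, possibly not the balanced
      one; only the values of \<open>kappa\<close> are known to agree.\<close>
    have "kappa n x (fst (\<gamma> c)) (snd (\<gamma> c)) (alpha_hat (snd (\<gamma> c)))
        = kappa n x (fst (\<gamma> c)) (snd (\<gamma> c)) (odds_scale (balancing \<beta> c) c)"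
      unfolding \<gamma>_def fst_conv snd_conv
      using alpha_hat[OF bl(2)] bl(1) by (rule kappa_minimizers_equal)
    also have "\<dots> = \<phi> c"
      unfolding \<gamma>_def \<phi>_def fst_conv snd_conv blend_balancing[OF c(1), symmetric]
      using \<rho> c balancing_pos[OF c] by (rule kappa_odds_scale)
    finally show ?thesis
      using bl(2) by (simp only: \<gamma>_def split fst_conv snd_conv simp_thms)
  qed
  then have ev: "\<forall>\<^sub>F c in nhds a. \<gamma> c \<in> etm_domain n x \<and>
      (\<lambda>(\<rho>, \<beta>). kappa n x \<rho> \<beta> (alpha_hat \<beta>)) (\<gamma> c) = \<phi> c"
    using a by (intro eventually_mono[OF eventually_nhds_in_open[of "{0<..<1}" a]]) auto
  have "\<gamma> a = (\<rho>, \<beta>)"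
    unfolding \<gamma>_def bal1 by simp
  then have "0 + w * a - w * alpha_tilde n \<rho> = 0"
    using local_maximizer_on_path_deriv_zero[OF _ cont ev deriv] max by (simp only:)
  then have "w * (a - alpha_tilde n \<rho>) = 0"
    by (simp only: right_diff_distrib add_0)
  \<comment> \<open>If \<open>v = 0\<close>, the scale has slope 0 and the curve says nothing about
    \<open>a\<close>; that degenerate case is settled directly.\<close>
  then consider "alpha_tilde n \<rho> = a" | "v = 0"
    using a(1) by (auto simp: w_def)
  then show ?thesis
  proof cases
    case 1
    then show ?thesis using one by simp
  next
    case 2
    \<comment> \<open>\<open>v\<close> is the variance of \<open>1 / blend a (tilt \<beta> y)\<close>, so all tilts are \<open>1\<close>.\<close>
    have "pooled_mean (\<lambda>y. (1 / blend a (tilt \<beta> y))\<^sup>2 - 2 * (1 / blend a (tilt \<beta> y)) + 1) = 0"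
      unfolding pooled_mean_add pooled_mean_diff pooled_mean_cmult mean_inverse_def[symmetric]
      using 2 by (simp add: v_def one)
    moreover have "z\<^sup>2 - 2 * z + 1 = (z - 1)\<^sup>2" for z :: real
      by (simp add: power2_diff)
    ultimately have "pooled_mean (\<lambda>y. (1 / blend a (tilt \<beta> y) - 1)\<^sup>2) = 0"
      by (simp only:)
    then have "(1 / blend a (tilt \<beta> (x j i)) - 1)\<^sup>2 = 0" if "j \<in> {1..3}" "i \<in> {1..n j}" for j i
      by (rule pooled_mean_nonneg_eq_0) (use that in auto)
    then have "tilt \<beta> (x j i) = 1" if "j \<in> {1..3}" "i \<in> {1..n j}" for j i
      using that a blend_tilt_pos[OF a, of \<beta> "x j i"] by (fastforce simp: field_simps)
    then have "mean_inverse \<beta> (alpha_tilde n \<rho>) = pooled_mean (\<lambda>y. 1)"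
      unfolding mean_inverse_def by (intro pooled_mean_cong) simp
    then show ?thesis by simp
  qed
qed

section \<open>The continuous map from the SLR domain to the ETM domain\<close>

definition rebalance :: "real \<times> (real \<times> (real ^ 'p)) \<Rightarrow> real \<times> (real \<times> (real ^ 'p))" where
  "rebalance q = (let s = balancing (snd q) (alpha_tilde n (fst q))
     in (odds_scale s (fst q), intercept_shift s (snd q)))"

lemma rebalance_in_etm_domain:
  assumes "q \<in> slr_domain"
  shows "rebalance q \<in> etm_domain n x"
  using assms
  by (auto simp: rebalance_def Let_def slr_domain_def alpha_tilde_bounds intro!: kappa_minimizer_balanced(2))

text \<open>Rescaling cannot lower \<open>kappa\<close> at \<open>alpha_tilde\<close>, and after
  balancing the rescaled \<open>alpha_tilde\<close> is a minimizer, so it yields the profile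
  value.\<close>

lemma slr_le_etm_rebalance:
  assumes q: "q \<in> slr_domain"
    and alpha_hat: "\<And>\<rho> \<beta>. (\<rho>, \<beta>) \<in> etm_domain n x \<Longrightarrow> kappa_minimizer n x \<rho> \<beta> (alpha_hat \<beta>)"
  shows "(\<lambda>(\<rho>, \<beta>). kappa n x \<rho> \<beta> (alpha_tilde n \<rho>)) q
    \<le> (\<lambda>(\<rho>, \<beta>). kappa n x \<rho> \<beta> (alpha_hat \<beta>)) (rebalance q)"
proof -
  obtain \<rho> \<beta> where [simp]: "q = (\<rho>, \<beta>)" and \<rho>: "0 < \<rho>" "\<rho> < 1"
    using q by (cases q) (auto simp: slr_domain_def)
  note a = alpha_tilde_bounds[OF \<rho>]
  define s where "s = balancing \<beta> (alpha_tilde n \<rho>)"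
  have "kappa n x \<rho> \<beta> (alpha_tilde n \<rho>)
      \<le> kappa n x (odds_scale s \<rho>) (intercept_shift s \<beta>) (odds_scale s (alpha_tilde n \<rho>))"
    using \<rho> balancing_pos[OF a] by (intro kappa_alpha_tilde_le) (simp_all add: s_def)
  also have "\<dots> \<le> kappa n x (odds_scale s \<rho>) (intercept_shift s \<beta>) (alpha_hat (intercept_shift s \<beta>))"
    using kappa_minimizer_balanced[OF \<rho> a, of \<beta>] alpha_hat
    by (auto simp: s_def kappa_minimizer_def is_arg_min_linorder)
  finally show ?thesis
    by (simp add: rebalance_def s_def Let_def)
qed

text \<open>Pulls an ETM neighborhood of a fixed point back to an SLR neighborhood.\<close>

lemma isCont_rebalance:
  assumes "q \<in> slr_domain"
  shows "isCont rebalance q"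
proof -
  have a: "0 < alpha_tilde n (fst q)" "alpha_tilde n (fst q) < 1"
    using assms by (auto simp: slr_domain_def intro!: alpha_tilde_bounds)
  have at: "isCont (\<lambda>q. alpha_tilde n (fst q)) q"
    unfolding alpha_tilde_def using N_pos by (intro continuous_intros) simp
  have inv: "isCont (\<lambda>q. 1 / blend (alpha_tilde n (fst q)) (tilt (snd q) y)) q" for y
    using at blend_tilt_pos[OF a, of "snd q" y]
    unfolding tilt_def by (intro continuous_intros) simp_all
  then have h: "isCont (\<lambda>q. mean_inverse (snd q) (alpha_tilde n (fst q))) q"
    unfolding mean_inverse_def pooled_mean_def using N_pos by (intro continuous_divide continuous_sum continuous_const inv) simp_all
  have bal: "isCont (\<lambda>q. balancing (snd q) (alpha_tilde n (fst q))) q"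
    unfolding balancing_def using at h a mean_inverse_pos[OF a, of "snd q"]
    by (intro continuous_intros) simp_all
  have pos: "0 < balancing (snd q) (alpha_tilde n (fst q))"
    using a by (rule balancing_pos)
  then have "0 < blend (fst q) (balancing (snd q) (alpha_tilde n (fst q)))"
    using assms by (intro blend_pos) (auto simp: slr_domain_def)
  then show ?thesis
    unfolding rebalance_def Let_def odds_scale_def intercept_shift_def
    using bal pos by (intro continuous_intros isCont_ln') simp_all
qed

lemma rebalance_fixed:
  assumes "(\<rho>, \<beta>) \<in> slr_domain" "mean_inverse \<beta> (alpha_tilde n \<rho>) = 1"
  shows "rebalance (\<rho>, \<beta>) = (\<rho>, \<beta>)"
  using assms by (simp add: rebalance_def balancing_eq_1 alpha_tilde_bounds slr_domain_def)

end

text \<open>The premise on \<open>alpha_hat\<close> can be met by \<open>ex_alpha_hat\<close>; it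
  permits any choice among several minimizers and any values off the ETM domain.\<close>

theorem proposition1:
  fixes n :: "nat \<Rightarrow> nat"
    and x :: "nat \<Rightarrow> nat \<Rightarrow> real ^ 'p"
    and alpha_hat :: "real \<times> (real ^ 'p) \<Rightarrow> real"
    and \<rho>_hat :: real and \<beta>_hat :: "real \<times> (real ^ 'p)"
  assumes "n 1 \<ge> 1" and "n 2 \<ge> 1" and "n 3 \<ge> 1"
    and alpha_hat: "\<And>\<rho> \<beta>. (\<rho>, \<beta>) \<in> etm_domain n x \<Longrightarrow> kappa_minimizer n x \<rho> \<beta> (alpha_hat \<beta>)"
  shows "(local_maximizer_on slr_domain
            (\<lambda>(\<rho>, \<beta>). kappa n x \<rho> \<beta> (alpha_tilde n \<rho>)) (\<rho>_hat, \<beta>_hat)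
          \<longleftrightarrow>
          local_maximizer_on (etm_domain n x)
            (\<lambda>(\<rho>, \<beta>). kappa n x \<rho> \<beta> (alpha_hat \<beta>)) (\<rho>_hat, \<beta>_hat))
       \<and> (global_maximizer_on slr_domain
            (\<lambda>(\<rho>, \<beta>). kappa n x \<rho> \<beta> (alpha_tilde n \<rho>)) (\<rho>_hat, \<beta>_hat)
          \<longleftrightarrow>
          global_maximizer_on (etm_domain n x)
            (\<lambda>(\<rho>, \<beta>). kappa n x \<rho> \<beta> (alpha_hat \<beta>)) (\<rho>_hat, \<beta>_hat))"
proof -
  interpret three_samples n x
    using assms by unfold_locales
  let ?p = "(\<rho>_hat, \<beta>_hat)"
  define f where "f = (\<lambda>(\<rho>, \<beta>). kappa n x \<rho> \<beta> (alpha_tilde n \<rho>))"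
  define g where "g = (\<lambda>(\<rho>, \<beta>). kappa n x \<rho> \<beta> (alpha_hat \<beta>))"
  have dom: "etm_domain n x \<subseteq> slr_domain"
    by (auto simp: etm_domain_def slr_domain_def)
  have g_le_f: "g q \<le> f q" if "q \<in> etm_domain n x" for q
  proof -
    obtain \<rho> \<beta> where q: "q = (\<rho>, \<beta>)" by (cases q)
    have "0 < \<rho>" "\<rho> < 1"
      using that by (auto simp: q etm_domain_def)
    then show ?thesis
      using alpha_hat[of \<rho> \<beta>] that alpha_tilde_bounds[of \<rho>]
      by (simp add: q f_def g_def kappa_minimizer_def is_arg_min_linorder)
  qed
  have f_le_g: "f q \<le> g (rebalance q)" if "q \<in> slr_domain" for q
    unfolding f_def g_def using that alpha_hat by (rule slr_le_etm_rebalance)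
  have slr_stat: "?p \<in> slr_domain \<and> rebalance ?p = ?p" if "local_maximizer_on slr_domain f ?p"
    using that slr_local_maximizer_stationary rebalance_fixed
    by (auto simp: f_def local_maximizer_on_def)
  have etm_stat: "rebalance ?p = ?p" if "local_maximizer_on (etm_domain n x) g ?p"
  proof (rule rebalance_fixed)
    show "?p \<in> slr_domain"
      using that dom by (auto simp: local_maximizer_on_def)
    show "mean_inverse \<beta>_hat (alpha_tilde n \<rho>_hat) = 1"
      using that alpha_hat unfolding g_def by (rule etm_local_maximizer_stationary)
  qed
  \<comment> \<open>As \<open>?p\<close> equals its own image, it lies in the ETM domain, and
    \<open>f ?p \<le> g (rebalance ?p) = g ?p \<le> f ?p\<close> collapses.\<close>
  have slr_eq: "?p \<in> etm_domain n x \<and> g ?p = f ?p" if "local_maximizer_on slr_domain f ?p"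
    using slr_stat[OF that] rebalance_in_etm_domain[of ?p] f_le_g[of ?p] g_le_f[of ?p] by auto
  have global_local: "local_maximizer_on D F ?p" if "global_maximizer_on D F ?p"
    for D :: "(real \<times> (real \<times> (real ^ 'p))) set" and F
    using that zero_less_one[where 'a = real]
    unfolding global_maximizer_on_def local_maximizer_on_def by blast
  have "local_maximizer_on (etm_domain n x) g ?p" if max: "local_maximizer_on slr_domain f ?p"
  proof -
    obtain \<epsilon> where "0 < \<epsilon>" and \<epsilon>: "\<And>q. q \<in> slr_domain \<Longrightarrow> dist q ?p < \<epsilon> \<Longrightarrow> f q \<le> f ?p"
      using max unfolding local_maximizer_on_def by blast
    then have "\<forall>q\<in>etm_domain n x. dist q ?p < \<epsilon> \<longrightarrow> g q \<le> g ?p"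
      using slr_eq[OF max] g_le_f dom by (metis order_trans subsetD)
    then show ?thesis
      using slr_eq[OF max] \<open>0 < \<epsilon>\<close> unfolding local_maximizer_on_def by blast
  qed
  moreover have "local_maximizer_on slr_domain f ?p" if max: "local_maximizer_on (etm_domain n x) g ?p"
  proof -
    have p: "?p \<in> etm_domain n x" "?p \<in> slr_domain"
      using max dom by (auto simp: local_maximizer_on_def)
    obtain \<epsilon> where "0 < \<epsilon>" and \<epsilon>: "\<And>q. q \<in> etm_domain n x \<Longrightarrow> dist q ?p < \<epsilon> \<Longrightarrow> g q \<le> g ?p"
      using max unfolding local_maximizer_on_def by blast
    obtain \<delta> where "0 < \<delta>" and \<delta>: "\<And>q. dist q ?p < \<delta> \<Longrightarrow> dist (rebalance q) ?p < \<epsilon>"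
      using isCont_rebalance[OF p(2)] etm_stat[OF max] \<open>0 < \<epsilon>\<close> by (metis continuous_at_eps_delta)
    \<comment> \<open>The chain is \<open>f q \<le> g (rebalance q) \<le> g ?p \<le> f ?p\<close>;
      its middle link holds because \<open>rebalance q\<close> stays near
      \<open>rebalance ?p = ?p\<close>.\<close>
    have "f q \<le> f ?p" if "q \<in> slr_domain" "dist q ?p < \<delta>" for q
      using f_le_g[OF that(1)] \<epsilon>[OF rebalance_in_etm_domain[OF that(1)] \<delta>[OF that(2)]] g_le_f[OF p(1)]
      by linarith
    then show ?thesis
      using p \<open>0 < \<delta>\<close> unfolding local_maximizer_on_def by blast
  qed
  moreover have "global_maximizer_on (etm_domain n x) g ?p" if max: "global_maximizer_on slr_domain f ?p"
    using max slr_eq[OF global_local[OF max]] g_le_f dom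
    unfolding global_maximizer_on_def by (metis order_trans subsetD)
  \<comment> \<open>The same chain, now for every \<open>q\<close> in the SLR domain, with global
    maximality as the middle link.\<close>
  moreover have "global_maximizer_on slr_domain f ?p" if max: "global_maximizer_on (etm_domain n x) g ?p"
    using max f_le_g g_le_f rebalance_in_etm_domain dom
    unfolding global_maximizer_on_def by (meson order_trans subsetD)
  ultimately show ?thesis
    unfolding f_def g_def by blast
qed

end
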